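(* Let $r$ be a positive integer, let $X$ and $Y$ be $r$-sets, let $x$ be a dismantlable vertex of $X$, and let $i:X\setminus x\hookrightarrow X$ be the inclusion. Then the two order preserving maps $$i^*:\mathrm{Hom}(X,Y)\to\mathrm{Hom}(X\setminus x,Y),\qquad i_*:\mathrm{Hom}(Y,X\setminus x)\to\mathrm{Hom}(Y,X)$$ are strong equivalences of posets.
   Context: Fix a positive integer $r$. An $r$-set is a pair $X=(V(X),R(X))$ consisting of a set $V(X)$ (possibly infinite) and a subset $R(X)\subset V(X)^r$. A homomorphism $f:X\to Y$ is a map $f:V(X)\to V(Y)$ with $f^{\times r}(R(X))\subset R(Y)$. A multi-homomorphism from $X$ to $Y$ is a map $\eta:V(X)\to 2^{V(Y)}\setminus\{\emptyset\}$ such that $\eta(x_1)\times\cdots\times\eta(x_r)\subset R(Y)$ for every $(x_1,\dots,x_r)\in R(X)$. $\mathrm{Hom}(X,Y)$ is the poset of all multi-homomorphisms from $X$ to $Y$, ordered by $\eta\le\eta'$ iff $\eta(v)\subset\eta'(v)$ for all $v\in V(X)$. For a homomorphism $f:X\to Y$ and an $r$-set $Z$, $f^*:\mathrm{Hom}(Y,Z)\to\mathrm{Hom}(X,Z)$ is $f^*(\eta)(x)=\eta(f(x))$ and $f_*:\mathrm{Hom}(Z,X)\to\mathrm{Hom}(Z,Y)$ is $f_*(\eta)(z)=f(\eta(z))$. A vertex $x\in V(X)$ is dismantlable if there is $y\in V(X)\setminus\{x\}$ such that for every $i\in\{1,\dots,r\}$ and every $(x_1,\dots,x_r)\in R(X)$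 with $x_i=x$, one has $(x_1,\dots,x_{i-1},y,x_{i+1},\dots,x_r)\in R(X)$. $X\setminus x$ is the $r$-set with $V(X\setminus x)=V(X)\setminus\{x\}$ and $R(X\setminus x)=(V(X)\setminus\{x\})^r\cap R(X)$. For posets $P,Q$, $\mathrm{Poset}(P,Q)$ is the poset of order preserving maps $P\to Q$ with the pointwise order. Order preserving maps $f,g:P\to Q$ are strongly homotopic, $f\sim_s g$, if they lie in the same connected component of $\mathrm{Poset}(P,Q)$ (equivalently, are joined by a finite zigzag of comparable elements). An order preserving map $f:P\to Q$ is a strong equivalence if there is an order preserving $g:Q\to P$ with $gf\sim_s\mathrm{id}_P$ and $fg\sim_s\mathrm{id}_Q$. *)

theory Defs
  imports "HOL-Algebra.Order" "HOL-Library.FuncSet"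
begin

text \<open>
  Maps with a given domain are represented by functions that are extensional on it
  (value \<^const>\<open>undefined\<close> elsewhere), so that equality of functions is equality of maps.
  Posets are HOL-Algebra orders satisfying \<^const>\<open>partial_order\<close>.
\<close>

definition poset_maps :: "'a gorder \<Rightarrow> 'b gorder \<Rightarrow> ('a \<Rightarrow> 'b) gorder" where
  "poset_maps P Q =
    \<lparr> carrier = {f \<in> carrier P \<rightarrow>\<^sub>E carrier Q. isotone P Q f},
      eq = (=),
      le = (\<lambda>f g. \<forall>p \<in> carrier P. f p \<sqsubseteq>\<^bsub>Q\<^esub> g p) \<rparr>"

definition comparability :: "'a gorder \<Rightarrow> 'a rel" where
  "comparability P =
    {(a, b). a \<in> carrier P \<and> b \<in> carrier P \<and> (a \<sqsubseteq>\<^bsub>P\<^esub> b \<or> b \<sqsubseteq>\<^bsub>P\<^esub> a)}"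

definition same_component :: "'a gorder \<Rightarrow> 'a \<Rightarrow> 'a \<Rightarrow> bool" where
  "same_component P a b \<longleftrightarrow>
    a \<in> carrier P \<and> b \<in> carrier P \<and> (a, b) \<in> (comparability P)\<^sup>*"

definition strongly_homotopic ::
    "'a gorder \<Rightarrow> 'b gorder \<Rightarrow> ('a \<Rightarrow> 'b) \<Rightarrow> ('a \<Rightarrow> 'b) \<Rightarrow> bool" where
  "strongly_homotopic P Q f g \<longleftrightarrow> same_component (poset_maps P Q) f g"

definition strong_equivalence :: "'a gorder \<Rightarrow> 'b gorder \<Rightarrow> ('a \<Rightarrow> 'b) \<Rightarrow> bool" where
  "strong_equivalence P Q f \<longleftrightarrow>
    f \<in> carrier (poset_maps P Q) \<and>
    (\<exists>g \<in> carrier (poset_maps Q P).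
      strongly_homotopic P P (compose (carrier P) g f) (\<lambda>p\<in>carrier P. p) \<and>
      strongly_homotopic Q Q (compose (carrier Q) f g) (\<lambda>q\<in>carrier Q. q))"

lemma partial_order_poset_maps:
  assumes "partial_order P" "partial_order Q"
  shows "partial_order (poset_maps P Q)"
proof -
  interpret Q: partial_order Q by (rule assms)
  show ?thesis
  proof (unfold_locales, goal_cases)
    case (4 f)
    then show ?case by (auto simp: poset_maps_def)
  next
    case (5 f g)
    have "f = g"
      by (rule PiE_ext[of _ "carrier P" "\<lambda>_. carrier Q"])
         (use 5 in \<open>auto simp: poset_maps_def intro!: Q.le_antisym\<close>)
    then show ?case by (simp add: poset_maps_def)
  next
    case (6 f g h)
    then show ?case
      by (auto simp: poset_maps_def) (meson PiE_mem Q.le_trans)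
  qed (auto simp: poset_maps_def)
qed

text \<open>The \<open>r\<close>-tuples are lists of length \<open>r\<close>; positions are counted from 0.\<close>

record 'a rset =
  verts :: "'a set"
  rels :: "'a list set"

definition tuples :: "nat \<Rightarrow> 'a set \<Rightarrow> 'a list set" where
  "tuples r A = {xs. length xs = r \<and> set xs \<subseteq> A}"

definition is_rset :: "nat \<Rightarrow> 'a rset \<Rightarrow> bool" where
  "is_rset r X \<longleftrightarrow> rels X \<subseteq> tuples r (verts X)"

definition rset_hom :: "'a rset \<Rightarrow> 'b rset \<Rightarrow> ('a \<Rightarrow> 'b) set" where
  "rset_hom X Y = {f \<in> verts X \<rightarrow>\<^sub>E verts Y. map f ` rels X \<subseteq> rels Y}"

text \<open>\<^const>\<open>listset\<close> forms the product of a list of sets, as a set of lists.\<close>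

definition multi_homs :: "'a rset \<Rightarrow> 'b rset \<Rightarrow> ('a \<Rightarrow> 'b set) set" where
  "multi_homs X Y =
    {\<eta> \<in> verts X \<rightarrow>\<^sub>E (Pow (verts Y) - {{}}). \<forall>xs \<in> rels X. listset (map \<eta> xs) \<subseteq> rels Y}"

definition Hom :: "'a rset \<Rightarrow> 'b rset \<Rightarrow> ('a \<Rightarrow> 'b set) gorder" where
  "Hom X Y =
    \<lparr> carrier = multi_homs X Y,
      eq = (=),
      le = (\<lambda>\<eta> \<eta>'. \<forall>v \<in> verts X. \<eta> v \<subseteq> \<eta>' v) \<rparr>"

text \<open>
  For \<open>f : X \<rightarrow> Y\<close>, the maps \<open>f\<^sup>* : Hom(Y,Z) \<rightarrow> Hom(X,Z)\<close> and
  \<open>f\<^sub>* : Hom(Z,X) \<rightarrow> Hom(Z,Y)\<close>; the latter does not depend on \<open>Y\<close>.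
\<close>

definition hom_pullback ::
    "'a rset \<Rightarrow> 'b rset \<Rightarrow> 'c rset \<Rightarrow> ('a \<Rightarrow> 'b) \<Rightarrow> ('b \<Rightarrow> 'c set) \<Rightarrow> ('a \<Rightarrow> 'c set)" where
  "hom_pullback X Y Z f = (\<lambda>\<eta>\<in>carrier (Hom Y Z). \<lambda>x\<in>verts X. \<eta> (f x))"

definition hom_pushforward ::
    "'c rset \<Rightarrow> 'a rset \<Rightarrow> ('a \<Rightarrow> 'b) \<Rightarrow> ('c \<Rightarrow> 'a set) \<Rightarrow> ('c \<Rightarrow> 'b set)" where
  "hom_pushforward Z X f = (\<lambda>\<eta>\<in>carrier (Hom Z X). \<lambda>z\<in>verts Z. f ` \<eta> z)"

definition dismantlable :: "nat \<Rightarrow> 'a rset \<Rightarrow> 'a \<Rightarrow> bool" where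
  "dismantlable r X x \<longleftrightarrow>
    x \<in> verts X \<and>
    (\<exists>y \<in> verts X - {x}. \<forall>i < r. \<forall>xs \<in> rels X. xs ! i = x \<longrightarrow> xs[i := y] \<in> rels X)"

definition delete_vertex :: "nat \<Rightarrow> 'a rset \<Rightarrow> 'a \<Rightarrow> 'a rset" where
  "delete_vertex r X x =
    \<lparr> verts = verts X - {x}, rels = tuples r (verts X - {x}) \<inter> rels X \<rparr>"

definition inclusion :: "nat \<Rightarrow> 'a rset \<Rightarrow> 'a \<Rightarrow> 'a \<Rightarrow> 'a" where
  "inclusion r X x = (\<lambda>v\<in>verts (delete_vertex r X x). v)"

lemma partial_order_Hom: "partial_order (Hom X Y)"
proof (unfold_locales, goal_cases)
  case (5 f g)
  have "f = g"
    by (rule PiE_ext[of _ "verts X" "\<lambda>_. Pow (verts Y) - {{}}"])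
       (use 5 in \<open>auto simp: Hom_def multi_homs_def\<close>)
  then show ?case by (simp add: Hom_def)
qed (auto simp: Hom_def)

lemma is_rset_delete_vertex: "is_rset r (delete_vertex r X x)"
  by (auto simp: is_rset_def delete_vertex_def)

lemma inclusion_hom: "inclusion r X x \<in> rset_hom (delete_vertex r X x) X"
proof -
  have "map (inclusion r X x) xs = xs" if "xs \<in> rels (delete_vertex r X x)" for xs
    by (rule map_idI) (use that in \<open>auto simp: delete_vertex_def tuples_def inclusion_def\<close>)
  then show ?thesis
    by (auto simp: rset_hom_def inclusion_def delete_vertex_def)
qed

end

theory Submission
  imports Defs
begin

text \<open>
  If \<open>y\<close> dominates \<open>x\<close>, let \<open>f : X \<rightarrow> X \<setminus> x\<close> be the retraction sending \<open>x\<close> to \<open>y\<close>. Changing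
  any of the entries \<open>x\<close> of a related tuple into \<open>y\<close>, one after the other, stays inside the
  relation; hence \<open>\<theta>(v) = {v, f(v)}\<close> is a multi-homomorphism \<open>X \<rightarrow> X\<close>, and it lies above both
  the identity and \<open>f\<close>. Composition of multi-homomorphisms is monotone in either factor, so
  composing with \<open>\<theta>\<close> on the right (on the left) yields a poset map above both the identity and
  \<open>f\<^sup>* i\<^sup>*\<close> (\<open>i\<^sub>* f\<^sub>*\<close>), while \<open>i\<^sup>* f\<^sup>*\<close> and \<open>f\<^sub>* i\<^sub>*\<close> are identities.
\<close>

section \<open>Strong equivalences from retractions of posets\<close>

lemma poset_maps_closed:
  "F \<in> carrier (poset_maps P Q) \<Longrightarrow> p \<in> carrier P \<Longrightarrow> F p \<in> carrier Q"
  by (auto simp: poset_maps_def)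

text \<open>The common upper bound \<open>H\<close> gives the zigzag \<open>G F\<close>,
  \<open>H\<close>, identity in the poset of self-maps of \<open>P\<close>; on \<open>Q\<close> the
  composite is the identity outright. The same two homotopies serve both conclusions, since the
  definition is symmetric in a map and its homotopy inverse.\<close>

lemma strong_equivalence_retraction:
  assumes F: "F \<in> carrier (poset_maps P Q)" and G: "G \<in> carrier (poset_maps Q P)"
    and H: "H \<in> carrier (poset_maps P P)"
    and FG: "\<And>q. q \<in> carrier Q \<Longrightarrow> F (G q) = q"
    and le_H: "\<And>p. p \<in> carrier P \<Longrightarrow> p \<sqsubseteq>\<^bsub>P\<^esub> H p"
    and GF_le_H: "\<And>p. p \<in> carrier P \<Longrightarrow> G (F p) \<sqsubseteq>\<^bsub>P\<^esub> H p"
  shows "strong_equivalence P Q F" and "strong_equivalence Q P G"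
proof -
  have ids: "(\<lambda>p\<in>carrier P. p) \<in> carrier (poset_maps P P)"
    "(\<lambda>q\<in>carrier Q. q) \<in> carrier (poset_maps Q Q)"
    using F by (auto simp: poset_maps_def isotone_def)
  have GF: "compose (carrier P) G F \<in> carrier (poset_maps P P)"
    using F G by (auto simp: poset_maps_def isotone_def compose_def PiE_iff)
  have "(compose (carrier P) G F, H) \<in> comparability (poset_maps P P)"
    using GF H GF_le_H by (auto simp: comparability_def) (simp add: poset_maps_def compose_def)
  moreover have "(H, \<lambda>p\<in>carrier P. p) \<in> comparability (poset_maps P P)"
    using ids H le_H by (auto simp: comparability_def) (simp add: poset_maps_def)
  ultimately have 1: "strongly_homotopic P P (compose (carrier P) G F) (\<lambda>p\<in>carrier P. p)"
    using GF ids by (auto simp: strongly_homotopic_def same_component_def)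
  have "compose (carrier Q) F G = (\<lambda>q\<in>carrier Q. q)"
    using FG by (auto simp: compose_def)
  then have 2: "strongly_homotopic Q Q (compose (carrier Q) F G) (\<lambda>q\<in>carrier Q. q)"
    using ids by (auto simp: strongly_homotopic_def same_component_def)
  show "strong_equivalence P Q F" "strong_equivalence Q P G"
    using F G 1 2 by (auto simp: strong_equivalence_def)
qed

section \<open>Multi-homomorphisms and their composition\<close>

lemma in_listset_iff_list_all2: "xs \<in> listset As \<longleftrightarrow> list_all2 (\<in>) xs As"
  by (induction As arbitrary: xs) (auto simp: set_Cons_def list_all2_Cons2)

text \<open>Stating the condition through entrywise choices brings in the relator
  \<open>list_all2\<close>, which commutes with composition of relations.\<close>

lemma multi_homs_iff:
  "\<eta> \<in> multi_homs X Y \<longleftrightarrow> \<eta> \<in> verts X \<rightarrow>\<^sub>E (Pow (verts Y) - {{}}) \<and>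
     (\<forall>xs\<in>rels X. \<forall>ys. list_all2 (\<lambda>y x. y \<in> \<eta> x) ys xs \<longrightarrow> ys \<in> rels Y)"
  by (auto simp: multi_homs_def in_listset_iff_list_all2 list_all2_map2 subset_iff)

text \<open>Kleisli composition for the powerset monad: \<theta> acts first, then \<eta>. The
  restriction to \<open>verts X\<close> makes the result extensional.\<close>

definition multi_comp ::
    "'a rset \<Rightarrow> ('b \<Rightarrow> 'c set) \<Rightarrow> ('a \<Rightarrow> 'b set) \<Rightarrow> ('a \<Rightarrow> 'c set)" where
  "multi_comp X \<eta> \<theta> = (\<lambda>v\<in>verts X. \<Union> (\<eta> ` \<theta> v))"

lemma multi_comp_in_multi_homs:
  assumes X: "is_rset r X" and \<theta>: "\<theta> \<in> multi_homs X Y" and \<eta>: "\<eta> \<in> multi_homs Y Z"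
  shows "multi_comp X \<eta> \<theta> \<in> multi_homs X Z"
  unfolding multi_homs_iff
proof (intro conjI ballI allI impI)
  have "\<Union> (\<eta> ` \<theta> v) \<in> Pow (verts Z) - {{}}" if "v \<in> verts X" for v
  proof -
    have \<theta>v: "\<theta> v \<subseteq> verts Y" "\<theta> v \<noteq> {}"
      using \<theta> that by (auto simp: multi_homs_def)
    have \<eta>u: "\<eta> u \<subseteq> verts Z" "\<eta> u \<noteq> {}" if "u \<in> verts Y" for u
      using \<eta> that by (auto simp: multi_homs_def)
    have "\<Union> (\<eta> ` \<theta> v) \<subseteq> verts Z"
      by (intro UN_least \<eta>u(1) subsetD[OF \<theta>v(1)])
    moreover obtain u where "u \<in> \<theta> v" using \<theta>v(2) by auto
    with \<eta>u(2)[of u] \<theta>v(1) have "\<Union> (\<eta> ` \<theta> v) \<noteq> {}" by auto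
    ultimately show ?thesis by simp
  qed
  then show "multi_comp X \<eta> \<theta> \<in> verts X \<rightarrow>\<^sub>E Pow (verts Z) - {{}}"
    by (simp add: multi_comp_def)
next
  fix xs zs
  assume xs: "xs \<in> rels X" and zs: "list_all2 (\<lambda>z v. z \<in> multi_comp X \<eta> \<theta> v) zs xs"
  have "set xs \<subseteq> verts X"
    using X xs by (auto simp: is_rset_def tuples_def)
  \<comment> \<open>Each entry of \<open>zs\<close> comes from some entry chosen by \<theta>.
    Collecting these gives a tuple \<open>us\<close>, related in \<open>Y\<close> because of
    \<theta>, and \<eta> then carries it to \<open>zs\<close>.\<close>
  then have "list_all2 ((\<lambda>z u. z \<in> \<eta> u) OO (\<lambda>u v. u \<in> \<theta> v)) zs xs"
    using zs by (elim list.rel_mono_strong) (auto simp: multi_comp_def relcompp_apply subset_iff split: if_splits)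
  then obtain us where "list_all2 (\<lambda>z u. z \<in> \<eta> u) zs us" "list_all2 (\<lambda>u v. u \<in> \<theta> v) us xs"
    by (auto simp: list.rel_compp relcompp_apply)
  then show "zs \<in> rels Z"
    using xs \<theta> \<eta> by (auto simp: multi_homs_iff)
qed

text \<open>\<open>isotone\<close> also asks that both sides be weak partial orders. Settling this
  once leaves only closure and monotonicity to check.\<close>

lemma Hom_poset_maps_iff:
  "F \<in> carrier (poset_maps (Hom A B) (Hom C D)) \<longleftrightarrow>
     F \<in> multi_homs A B \<rightarrow>\<^sub>E multi_homs C D \<and>
     (\<forall>\<eta>\<in>multi_homs A B. \<forall>\<eta>'\<in>multi_homs A B.
        (\<forall>v\<in>verts A. \<eta> v \<subseteq> \<eta>' v) \<longrightarrow> (\<forall>v\<in>verts C. F \<eta> v \<subseteq> F \<eta>' v))"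
  using partial_order.axioms(1)[OF partial_order_Hom[of A B]]
    partial_order.axioms(1)[OF partial_order_Hom[of C D]]
  by (simp add: poset_maps_def isotone_def) (simp add: Hom_def)

lemma precompose_poset_map:
  assumes "is_rset r X" "\<theta> \<in> multi_homs X Y"
  shows "(\<lambda>\<eta>\<in>carrier (Hom Y Z). multi_comp X \<eta> \<theta>) \<in> carrier (poset_maps (Hom Y Z) (Hom X Z))"
proof -
  have "multi_comp X \<eta> \<theta> v \<subseteq> multi_comp X \<eta>' \<theta> v"
    if "\<forall>u\<in>verts Y. \<eta> u \<subseteq> \<eta>' u" "v \<in> verts X" for \<eta> \<eta>' :: "'b \<Rightarrow> 'c set" and v
  proof -
    \<comment> \<open>The order compares \<eta> and \<eta>' on \<open>verts Y\<close> only, so the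
      union must range over vertices of \<open>Y\<close>.\<close>
    have "\<theta> v \<subseteq> verts Y"
      using assms that by (auto simp: multi_homs_def)
    with that show ?thesis by (auto simp: multi_comp_def)
  qed
  then show ?thesis
    using multi_comp_in_multi_homs[OF assms, of _ Z]
    by (simp add: Hom_poset_maps_iff) (simp add: Hom_def Pi_iff)
qed

lemma postcompose_poset_map:
  assumes "is_rset r Z" "\<theta> \<in> multi_homs X Y"
  shows "(\<lambda>\<eta>\<in>carrier (Hom Z X). multi_comp Z \<theta> \<eta>) \<in> carrier (poset_maps (Hom Z X) (Hom Z Y))"
proof -
  have "multi_comp Z \<theta> \<eta> v \<subseteq> multi_comp Z \<theta> \<eta>' v"
    if "\<forall>u\<in>verts Z. \<eta> u \<subseteq> \<eta>' u" "v \<in> verts Z" for \<eta> \<eta>' v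
    using that by (auto simp: multi_comp_def)
  then show ?thesis
    using multi_comp_in_multi_homs[OF assms(1) _ assms(2)]
    by (simp add: Hom_poset_maps_iff) (simp add: Hom_def Pi_iff)
qed

section \<open>Pullback and pushforward as compositions with a homomorphism\<close>

definition singleton_multi_hom :: "'a rset \<Rightarrow> ('a \<Rightarrow> 'b) \<Rightarrow> 'a \<Rightarrow> 'b set" where
  "singleton_multi_hom X f = (\<lambda>v\<in>verts X. {f v})"

lemma singleton_multi_hom_in_multi_homs:
  assumes "is_rset r X" "f \<in> rset_hom X Y"
  shows "singleton_multi_hom X f \<in> multi_homs X Y"
  unfolding multi_homs_iff
proof (intro conjI ballI allI impI)
  show "singleton_multi_hom X f \<in> verts X \<rightarrow>\<^sub>E Pow (verts Y) - {{}}"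
    using assms by (auto simp: singleton_multi_hom_def rset_hom_def)
next
  fix xs ys
  assume xs: "xs \<in> rels X" and ys: "list_all2 (\<lambda>y v. y \<in> singleton_multi_hom X f v) ys xs"
  have "set xs \<subseteq> verts X"
    using assms xs by (auto simp: is_rset_def tuples_def)
  then have "list_all2 (\<lambda>y v. y = f v) ys xs"
    using ys by (elim list.rel_mono_strong) (auto simp: singleton_multi_hom_def)
  then have "ys = map f xs"
    by (simp add: list_all2_conv_all_nth list_eq_iff_nth_eq)
  then show "ys \<in> rels Y"
    using assms xs by (auto simp: rset_hom_def)
qed

lemma hom_pullback_eq_precompose:
  "hom_pullback X Y Z f = (\<lambda>\<eta>\<in>carrier (Hom Y Z). multi_comp X \<eta> (singleton_multi_hom X f))"
  by (auto simp: hom_pullback_def multi_comp_def singleton_multi_hom_def fun_eq_iff)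

lemma hom_pushforward_eq_postcompose:
  "hom_pushforward Z X f = (\<lambda>\<eta>\<in>carrier (Hom Z X). multi_comp Z (singleton_multi_hom X f) \<eta>)"
proof -
  have image: "f ` \<eta> z = \<Union> (singleton_multi_hom X f ` \<eta> z)"
    if "\<eta> \<in> carrier (Hom Z X)" "z \<in> verts Z" for \<eta> z
  proof -
    \<comment> \<open>Outside \<open>verts X\<close> the singleton map is \<open>undefined\<close>,
      so the values of \<eta> must be known to lie inside.\<close>
    have "\<eta> z \<subseteq> verts X"
      using that by (auto simp: Hom_def multi_homs_def)
    then show ?thesis by (auto simp: singleton_multi_hom_def)
  qed
  show ?thesis
    unfolding hom_pushforward_def multi_comp_def by (intro restrict_ext image)
qed

lemma hom_pullback_poset_map:
  assumes "is_rset r X" "f \<in> rset_hom X Y"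
  shows "hom_pullback X Y Z f \<in> carrier (poset_maps (Hom Y Z) (Hom X Z))"
  unfolding hom_pullback_eq_precompose
  by (rule precompose_poset_map[OF assms(1) singleton_multi_hom_in_multi_homs[OF assms]])

lemma hom_pushforward_poset_map:
  assumes "is_rset r Z" "is_rset r X" "f \<in> rset_hom X Y"
  shows "hom_pushforward Z X f \<in> carrier (poset_maps (Hom Z X) (Hom Z Y))"
  unfolding hom_pushforward_eq_postcompose
  by (rule postcompose_poset_map[OF assms(1) singleton_multi_hom_in_multi_homs[OF assms(2,3)]])

section \<open>Dismantlable vertices\<close>

lemma replace_entries_in_rels:
  assumes X: "is_rset r X"
    and y: "\<And>i xs. i < r \<Longrightarrow> xs \<in> rels X \<Longrightarrow> xs ! i = x \<Longrightarrow> xs[i := y] \<in> rels X"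
    and xs: "xs \<in> rels X" and ys: "list_all2 (\<lambda>w v. w = v \<or> v = x \<and> w = y) ys xs"
  shows "ys \<in> rels X"
proof -
  have len: "length xs = r" "length ys = r"
    using X xs ys by (auto simp: is_rset_def tuples_def list_all2_lengthD)
  \<comment> \<open>Interpolate between \<open>xs\<close> and \<open>ys\<close>: consecutive hybrids
    differ at most in position \<open>k\<close>, where the earlier one still has the entry of
    \<open>xs\<close>. Either that entry stays, or it is \<open>x\<close> and becomes
    \<open>y\<close>, which is the single replacement allowed by hypothesis.\<close>
  have "k \<le> r \<Longrightarrow> take k ys @ drop k xs \<in> rels X" for k
  proof (induction k)
    case 0
    then show ?case using xs by simp
  next
    case (Suc k)
    let ?zs = "take k ys @ drop k xs"
    have zs: "?zs \<in> rels X" "k < r" using Suc by auto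
    have nth: "?zs ! k = xs ! k" using zs len by (simp add: nth_append)
    have "take (Suc k) ys @ drop (Suc k) xs = ?zs[k := ys ! k]"
      using zs len by (intro nth_equalityI) (auto simp: nth_append nth_list_update less_Suc_eq)
    moreover have "ys ! k = xs ! k \<or> xs ! k = x \<and> ys ! k = y"
      using ys zs len by (auto simp: list_all2_conv_all_nth)
    ultimately show ?case
      using y[OF zs(2,1)] zs nth by (metis list_update_id)
  qed
  from this[of r] show ?thesis using len by simp
qed

theorem theorem5p6:
  fixes r :: nat and X :: "'a rset" and Y :: "'b rset" and x :: 'a
  assumes "r > 0"
    and "is_rset r X" and "is_rset r Y"
    and "dismantlable r X x"
  shows "strong_equivalence (Hom X Y) (Hom (delete_vertex r X x) Y)
           (hom_pullback (delete_vertex r X x) X Y (inclusion r X x)) \<and>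
         strong_equivalence (Hom Y (delete_vertex r X x)) (Hom Y X)
           (hom_pushforward Y (delete_vertex r X x) (inclusion r X x))"
proof -
  note X = \<open>is_rset r X\<close> and Y = \<open>is_rset r Y\<close>
  let ?D = "delete_vertex r X x" and ?i = "inclusion r X x"
  obtain y where y: "y \<in> verts X" "y \<noteq> x"
    and repl: "\<And>i xs. i < r \<Longrightarrow> xs \<in> rels X \<Longrightarrow> xs ! i = x \<Longrightarrow> xs[i := y] \<in> rels X"
    using \<open>dismantlable r X x\<close> by (auto simp: dismantlable_def)
  define f where "f = (\<lambda>v\<in>verts X. if v = x then y else v)"
  define \<theta> where "\<theta> = (\<lambda>v\<in>verts X. {v, f v})"
  have D: "is_rset r ?D" "verts ?D = verts X - {x}"
    by (simp_all add: is_rset_delete_vertex) (simp add: delete_vertex_def)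
  have rels_verts: "set xs \<subseteq> verts X" "length xs = r" if "xs \<in> rels X" for xs
    using X that by (auto simp: is_rset_def tuples_def)
  have f_verts: "f v \<in> verts X - {x}" if "v \<in> verts X" for v
    using y that by (auto simp: f_def)

  have \<theta>: "\<theta> \<in> multi_homs X X"
    unfolding multi_homs_iff
  proof (intro conjI ballI allI impI)
    show "\<theta> \<in> verts X \<rightarrow>\<^sub>E Pow (verts X) - {{}}"
      using f_verts by (auto simp: \<theta>_def)
  next
    fix xs ys
    assume xs: "xs \<in> rels X" and "list_all2 (\<lambda>w v. w \<in> \<theta> v) ys xs"
    then have "list_all2 (\<lambda>w v. w = v \<or> v = x \<and> w = y) ys xs"
      using rels_verts(1)[OF xs]
      by (elim list.rel_mono_strong) (auto simp: \<theta>_def f_def split: if_splits)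
    then show "ys \<in> rels X"
      by (rule replace_entries_in_rels[OF X _ xs, rotated]) (rule repl)
  qed

  have f: "f \<in> rset_hom X ?D"
  proof -
    have "map f xs \<in> rels ?D" if xs: "xs \<in> rels X" for xs
    proof -
      \<comment> \<open>Since \<open>f v\<close> lies in \<open>\<theta> v\<close>, the tuple
        \<open>map f xs\<close> is one of the choices already known to be related.\<close>
      have "list_all2 (\<lambda>w v. w \<in> \<theta> v) (map f xs) xs"
        using rels_verts[OF xs] by (auto simp: list_all2_conv_all_nth \<theta>_def subset_iff)
      then have "map f xs \<in> rels X"
        using \<theta> xs by (auto simp: multi_homs_iff)
      moreover have "f ` set xs \<subseteq> verts X - {x}"
        using f_verts rels_verts[OF xs] by blast
      ultimately show ?thesis
        using rels_verts[OF xs] by (auto simp: delete_vertex_def tuples_def)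
    qed
    moreover have "f \<in> verts X \<rightarrow>\<^sub>E verts ?D"
      using f_verts by (auto simp: D(2) f_def)
    ultimately show ?thesis by (auto simp: rset_hom_def)
  qed
  have fi: "f (?i v) = v" "?i v = v" if "v \<in> verts ?D" for v
    using that by (auto simp: inclusion_def f_def D)

  let ?pull_i = "hom_pullback ?D X Y ?i" and ?pull_f = "hom_pullback X ?D Y f"
  have "strong_equivalence (Hom X Y) (Hom ?D Y) ?pull_i"
  proof (rule strong_equivalence_retraction(1))
    show "?pull_i \<in> carrier (poset_maps (Hom X Y) (Hom ?D Y))"
      by (rule hom_pullback_poset_map[OF D(1) inclusion_hom])
    show pf: "?pull_f \<in> carrier (poset_maps (Hom ?D Y) (Hom X Y))"
      by (rule hom_pullback_poset_map[OF X f])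
    show "(\<lambda>\<eta>\<in>carrier (Hom X Y). multi_comp X \<eta> \<theta>) \<in> carrier (poset_maps (Hom X Y) (Hom X Y))"
      by (rule precompose_poset_map[OF X \<theta>])
    show "?pull_i (?pull_f \<eta>) = \<eta>" if \<eta>: "\<eta> \<in> carrier (Hom ?D Y)" for \<eta>
    proof -
      \<comment> \<open>\<open>hom_pullback\<close> is restricted to a carrier, so the outer
        pullback can be evaluated only after this membership.\<close>
      have "?pull_f \<eta> \<in> carrier (Hom X Y)"
        by (rule poset_maps_closed[OF pf \<eta>])
      moreover have "\<eta> \<in> extensional (verts ?D)"
        using \<eta> by (auto simp: Hom_def multi_homs_def PiE_def)
      ultimately show ?thesis
        using \<eta> fi by (intro extensionalityI[of _ "verts ?D"]) (auto simp: hom_pullback_def D)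
    qed
    fix \<eta> assume \<eta>: "\<eta> \<in> carrier (Hom X Y)"
    \<comment> \<open>At \<open>v\<close> the upper bound is the union of \<open>\<eta> v\<close>
      and \<open>\<eta> (f v)\<close>; it contains the values of both maps to be compared.\<close>
    show "\<eta> \<sqsubseteq>\<^bsub>Hom X Y\<^esub> (\<lambda>\<eta>\<in>carrier (Hom X Y). multi_comp X \<eta> \<theta>) \<eta>"
      using \<eta> by (auto simp: Hom_def multi_comp_def \<theta>_def)
    have "?pull_i \<eta> \<in> carrier (Hom ?D Y)"
      by (rule poset_maps_closed[OF hom_pullback_poset_map[OF D(1) inclusion_hom] \<eta>])
    then have "?pull_f (?pull_i \<eta>) v = \<eta> (f v)" if "v \<in> verts X" for v
      using \<eta> that f_verts[OF that] fi(2) by (auto simp: hom_pullback_def D)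
    then show "?pull_f (?pull_i \<eta>) \<sqsubseteq>\<^bsub>Hom X Y\<^esub> (\<lambda>\<eta>\<in>carrier (Hom X Y). multi_comp X \<eta> \<theta>) \<eta>"
      using \<eta> by (auto simp: Hom_def multi_comp_def \<theta>_def)
  qed

  moreover
  let ?push_i = "hom_pushforward Y ?D ?i" and ?push_f = "hom_pushforward Y X f"
  have "strong_equivalence (Hom Y ?D) (Hom Y X) ?push_i"
  \<comment> \<open>Covariance swaps the roles: the inclusion now induces the section
    \<open>G\<close>, and \<open>f\<close> induces the retraction \<open>F\<close>.\<close>
  proof (rule strong_equivalence_retraction(2))
    show pi: "?push_i \<in> carrier (poset_maps (Hom Y ?D) (Hom Y X))"
      by (rule hom_pushforward_poset_map[OF Y D(1) inclusion_hom])
    show pf: "?push_f \<in> carrier (poset_maps (Hom Y X) (Hom Y ?D))"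
      by (rule hom_pushforward_poset_map[OF Y X f])
    show "(\<lambda>\<eta>\<in>carrier (Hom Y X). multi_comp Y \<theta> \<eta>) \<in> carrier (poset_maps (Hom Y X) (Hom Y X))"
      by (rule postcompose_poset_map[OF Y \<theta>])
    \<comment> \<open>Both posets consist of functions of the same type, so pushing forward along
      the inclusion changes nothing; in particular \<eta> itself belongs to
      \<open>Hom Y X\<close>.\<close>
    have push_i: "?push_i \<eta> = \<eta>" if "\<eta> \<in> carrier (Hom Y ?D)" for \<eta>
    proof (rule extensionalityI[of _ "verts Y"])
      fix z assume z: "z \<in> verts Y"
      have "\<eta> z \<subseteq> verts ?D"
        using that z by (auto simp: Hom_def multi_homs_def)
      then have "?i ` \<eta> z = \<eta> z"
        using fi(2) by (force simp: image_iff)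
      then show "?push_i \<eta> z = \<eta> z"
        using that z by (simp add: hom_pushforward_def)
    qed (use that in \<open>auto simp: hom_pushforward_def Hom_def multi_homs_def PiE_def\<close>)
    show "?push_f (?push_i \<eta>) = \<eta>" if \<eta>: "\<eta> \<in> carrier (Hom Y ?D)" for \<eta>
    proof (rule extensionalityI[of _ "verts Y"])
      have \<eta>X: "\<eta> \<in> carrier (Hom Y X)"
        using poset_maps_closed[OF pi \<eta>] by (simp add: push_i[OF \<eta>])
      then show "?push_f (?push_i \<eta>) \<in> extensional (verts Y)"
        unfolding push_i[OF \<eta>] by (simp add: hom_pushforward_def)
      show "\<eta> \<in> extensional (verts Y)"
        using \<eta> by (auto simp: Hom_def multi_homs_def PiE_def)
      fix z assume z: "z \<in> verts Y"
      have "\<eta> z \<subseteq> verts ?D"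
        using \<eta> z by (auto simp: Hom_def multi_homs_def)
      then have "f ` \<eta> z = \<eta> z"
        using fi by (force simp: image_iff)
      then show "?push_f (?push_i \<eta>) z = \<eta> z"
        unfolding push_i[OF \<eta>] using \<eta>X z by (simp add: hom_pushforward_def)
    qed
    fix \<eta> assume \<eta>: "\<eta> \<in> carrier (Hom Y X)"
    have \<eta>_verts: "\<eta> z \<subseteq> verts X" if "z \<in> verts Y" for z
      using \<eta> that by (auto simp: Hom_def multi_homs_def)
    have comp: "multi_comp Y \<theta> \<eta> z = \<eta> z \<union> f ` \<eta> z" if "z \<in> verts Y" for z
      using \<eta>_verts[OF that] that by (auto simp: multi_comp_def \<theta>_def)
    show "\<eta> \<sqsubseteq>\<^bsub>Hom Y X\<^esub> (\<lambda>\<eta>\<in>carrier (Hom Y X). multi_comp Y \<theta> \<eta>) \<eta>"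
      using \<eta> comp by (auto simp: Hom_def)
    have "?push_f \<eta> \<in> carrier (Hom Y ?D)"
      by (rule poset_maps_closed[OF pf \<eta>])
    then have "?push_i (?push_f \<eta>) z = f ` \<eta> z" if "z \<in> verts Y" for z
      using \<eta> that by (simp add: push_i) (simp add: hom_pushforward_def)
    then show "?push_i (?push_f \<eta>) \<sqsubseteq>\<^bsub>Hom Y X\<^esub> (\<lambda>\<eta>\<in>carrier (Hom Y X). multi_comp Y \<theta> \<eta>) \<eta>"
      using \<eta> comp by (auto simp: Hom_def)
  qed
  ultimately show ?thesis ..
qed

end
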